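(* Let $f:\mathbb{R}^n\to\mathbb{R}$ be continuously differentiable, bounded below, and $(\alpha,L_0,L_1)$-smooth for some $\alpha\in[0,1]$ and $L_0,L_1\ge0$ (not both zero), and let the trust-region algorithm described in the context be applied to $f$, with set of successful iterations $\mathcal{S}$. Let $m\in\mathbb{N}$. At each iteration $k$, let $B_k$ be obtained from an initial matrix $B_{k,0}$ and a set of pairs $\{(s_i,y_i)\}_{i\in\mathcal{I}_k}$ stored at successful iterations, where $\mathcal{I}_k=\{i_0,\dots,i_{q_k-1}\}\subseteq\mathcal{S}$, $q_k=|\mathcal{I}_k|\le m$, $s_i\ne0$ and $y_i=\nabla f(x_i+s_i)-\nabla f(x_i)$. Assume that there exist $b_0',b_1'\ge0$ with $\|B_{k,0}\|\le b_0'+b_1'\|\nabla f(x_k)\|^\alpha$ for all $k\in\mathbb{N}$. Then, for each of the following updates, there exist $b_0,b_1\ge0$ such that $\|B_k\|\le b_0+b_1\|\nabla f(x_k)\|^\alpha$ for all $k\in\mathbb{N}$. (i) Limited-memory BFGS: $B_{k,0}\succ0$ and, for some $\omega_{\rm BFGS}\in(0,1)$, every stored pair satisfies $y_{i_j}\ne0$ and $s_{i_j}^Ty_{i_j}\ge\omega_{\rm BFGS}\|s_{i_j}\|\|y_{i_j}\|$; $B_k=B_{k,q_k}$ where, for $j=0,\dots,q_k-1$, $$B_{k,j+1}=B_{k,j}-\frac{B_{k,j}s_{i_j}s_{i_j}^TB_{k,j}}{s_{i_j}^TB_{k,j}s_{i_j}}+\frac{y_{i_j}y_{i_j}^T}{s_{i_j}^Ty_{i_j}}.$$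 (ii) Modified limited-memory BFGS: $B_{k,0}\succ0$ and, for some $\bar\omega_{\rm BFGS}\in(0,1)$, every stored pair satisfies $y_{i_j}\ne0$ and $s_{i_j}^Ty_{i_j}\ge\bar\omega_{\rm BFGS}\|y_{i_j}\|^2$; $B_k=B_{k,q_k}$ with the same recursion as in (i). (iii) Limited-memory SR1: with $z_{i_j}=y_{i_j}-B_{k,j}s_{i_j}$ and some $\omega_{\rm SR1}\in(0,1)$, every stored pair satisfies $z_{i_j}\ne0$ and $|s_{i_j}^Tz_{i_j}|\ge\omega_{\rm SR1}\|s_{i_j}\|\|z_{i_j}\|$; $B_k=B_{k,q_k}$ where, for $j=0,\dots,q_k-1$, $$B_{k,j+1}=B_{k,j}+\frac{(y_{i_j}-B_{k,j}s_{i_j})(y_{i_j}-B_{k,j}s_{i_j})^T}{(y_{i_j}-B_{k,j}s_{i_j})^Ts_{i_j}}.$$ (iv) Modified limited-memory SR1: with $z_{i_j}=y_{i_j}-B_{k,j}s_{i_j}$ and some $\bar\omega_{\rm SR1}\in(0,1)$, every stored pair satisfies $z_{i_j}\ne0$ and $|s_{i_j}^Tz_{i_j}|\ge\bar\omega_{\rm SR1}\|z_{i_j}\|^2$; $B_k=B_{k,q_k}$ with the same recursion as in (iii). (v) Limited-memory PSB: with $z_{i_j}=y_{i_j}-B_{k,j}s_{i_j}$, $B_k=B_{k,q_k}$ where, for $j=0,\dots,q_k-1$, $$B_{k,j+1}=B_{k,j}+\frac{z_{i_j}s_{i_j}^T+s_{i_j}z_{i_j}^T}{\|s_{i_j}\|^2}-\frac{z_{i_j}^Ts_{i_j}}{\|s_{i_j}\|^4}s_{i_j}s_{i_j}^T.$$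 (vi) Modified limited-memory PSB: for some $\bar\omega_{\rm PSB}>0$, every stored pair satisfies $\|s_{i_j}\|\ge\bar\omega_{\rm PSB}\|y_{i_j}-B_{k,j}s_{i_j}\|$; $B_k=B_{k,q_k}$ with the same recursion as in (v).
   Context: Convention: $0^0=1$; $\|\cdot\|$ is the Euclidean norm and its induced matrix norm. Smoothness. A continuously differentiable $f$ is $(\alpha,L_0,L_1)$-smooth (with $L_0>0$ or $L_1>0$) if for all $x,y\in\mathbb{R}^n$, $\|\nabla f(x)-\nabla f(y)\|\le\bigl(L_0+L_1\int_0^1\|\nabla f(x+t(y-x))\|^\alpha dt\bigr)\|x-y\|$. Trust-region algorithm. Constants: $\kappa_{\rm mdc}\in(0,\frac12]$, $0<\eta_1\le\eta_2<1$, $0<\gamma_1\le\gamma_2<1\le\gamma_3$, $x_0\in\mathbb{R}^n$, $\Delta_0>0$. For $k=0,1,\dots$: choose a symmetric $B_k\in\mathbb{R}^{n\times n}$ and let $m_k(s)=f(x_k)+\nabla f(x_k)^Ts+\frac12s^TB_ks$; compute any $s_k$ with $\|s_k\|\le\Delta_k$ and $m_k(0)-m_k(s_k)\ge\kappa_{\rm mdc}\|\nabla f(x_k)\|\min\{\|\nabla f(x_k)\|/\|B_k\|,\Delta_k\}$ (with $\|\nabla f(x_k)\|/\|B_k\|=+\infty$ if $B_k=0$); set $\rho_k=\frac{f(x_k)-f(x_k+s_k)}{m_k(0)-m_k(s_k)}$; set $x_{k+1}=x_k+s_k$ if $\rho_k\ge\eta_1$ (successful iteration), and $x_{k+1}=x_k$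 otherwise; choose $\Delta_{k+1}\in[\Delta_k,\gamma_3\Delta_k]$ if $\rho_k\ge\eta_2$, $\Delta_{k+1}\in[\gamma_2\Delta_k,\Delta_k]$ if $\eta_1\le\rho_k<\eta_2$, and $\Delta_{k+1}\in[\gamma_1\Delta_k,\gamma_2\Delta_k]$ if $\rho_k<\eta_1$. The constants $\omega_{\rm BFGS},\bar\omega_{\rm BFGS},\omega_{\rm SR1},\bar\omega_{\rm SR1},\bar\omega_{\rm PSB}$ are fixed, independent of $k$ and $j$; $\succ0$ means symmetric positive definite. *)

theory Defs
  imports "HOL-Analysis.Analysis"
begin

section \<open>Gradients and generalized smoothness\<close>

definition grad :: "(real^'n \<Rightarrow> real) \<Rightarrow> real^'n \<Rightarrow> real^'n" where
  "grad f x = (THE g. GDERIV f x :> g)"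

definition continuously_differentiable :: "(real^'n \<Rightarrow> real) \<Rightarrow> bool" where
  "continuously_differentiable f \<longleftrightarrow>
     (\<forall>x. f differentiable (at x)) \<and> continuous_on UNIV (grad f)"

lemma GDERIV_grad:
  fixes f :: "real^'n \<Rightarrow> real"
  assumes "f differentiable (at x)"
  shows "GDERIV f x :> grad f x"
proof -
  obtain D where D: "(f has_derivative D) (at x)"
    using assms unfolding differentiable_def by blast
  have lin: "linear D"
    using D by (rule has_derivative_linear)
  have "D = (\<lambda>h. h \<bullet> adjoint D 1)"
  proof
    fix h
    show "D h = h \<bullet> adjoint D 1"
      using adjoint_works[OF lin, of h 1] by simp
  qed
  then have ex: "GDERIV f x :> adjoint D 1"
    using D unfolding gderiv_def by simp
  have uniq: "g = adjoint D 1" if "GDERIV f x :> g" for g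
  proof -
    have "(\<lambda>h. h \<bullet> g) = (\<lambda>h. h \<bullet> adjoint D 1)"
      using that ex unfolding gderiv_def by (rule has_derivative_unique)
    then have "\<forall>h. h \<bullet> g = h \<bullet> adjoint D 1"
      by metis
    then show ?thesis
      using vector_eq_ldot by blast
  qed
  show ?thesis
    unfolding grad_def by (rule theI[of "\<lambda>g. GDERIV f x :> g", OF ex uniq])
qed

text \<open>Real powers of nonnegative numbers with the convention \<open>0\<^sup>0 = 1\<close>;
  the library has \<open>0 powr 0 = 0\<close>.\<close>

definition rpow :: "real \<Rightarrow> real \<Rightarrow> real" where
  "rpow x a = (if a = 0 then 1 else x powr a)"

definition gen_smooth :: "real \<Rightarrow> real \<Rightarrow> real \<Rightarrow> (real^'n \<Rightarrow> real) \<Rightarrow> bool" where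
  "gen_smooth \<alpha> L0 L1 f \<longleftrightarrow>
     continuously_differentiable f \<and> (L0 > 0 \<or> L1 > 0) \<and>
     (\<forall>x y. norm (grad f x - grad f y)
        \<le> (L0 + L1 * integral {0..1} (\<lambda>t. rpow (norm (grad f (x + t *\<^sub>R (y - x)))) \<alpha>))
            * norm (x - y))"


section \<open>Matrices\<close>

text \<open>The Euclidean induced norm; \<open>norm\<close> on \<open>real^'n^'n\<close> is the Frobenius norm.\<close>

definition mat_norm :: "real^'n^'n \<Rightarrow> real" where
  "mat_norm A = onorm (\<lambda>v. A *v v)"

definition sym_mat :: "real^'n^'n \<Rightarrow> bool" where
  "sym_mat A \<longleftrightarrow> transpose A = A"

definition pos_def :: "real^'n^'n \<Rightarrow> bool" where
  "pos_def A \<longleftrightarrow> sym_mat A \<and> (\<forall>v. v \<noteq> 0 \<longrightarrow> v \<bullet> (A *v v) > 0)"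

text \<open>The rank-one matrix \<open>u v\<^sup>T\<close>.\<close>

definition outer :: "real^'n \<Rightarrow> real^'n \<Rightarrow> real^'n^'n" where
  "outer u v = (\<chi> i j. u $ i * v $ j)"


section \<open>The trust-region algorithm\<close>

definition tr_model :: "(real^'n \<Rightarrow> real) \<Rightarrow> real^'n \<Rightarrow> real^'n^'n \<Rightarrow> real^'n \<Rightarrow> real" where
  "tr_model f x B s = f x + grad f x \<bullet> s + 1/2 * (s \<bullet> (B *v s))"

definition tr_ratio :: "(real^'n \<Rightarrow> real) \<Rightarrow> real^'n \<Rightarrow> real^'n^'n \<Rightarrow> real^'n \<Rightarrow> real" where
  "tr_ratio f x B s = (f x - f (x + s)) / (tr_model f x B 0 - tr_model f x B s)"

text \<open>\<open>min {\<parallel>g\<parallel> / \<parallel>B\<parallel>, \<Delta>}\<close>, where the quotient is read as \<open>+\<infinity>\<close> if \<open>B = 0\<close>.\<close>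

definition tr_min :: "real^'n \<Rightarrow> real^'n^'n \<Rightarrow> real \<Rightarrow> real" where
  "tr_min g B \<Delta> = (if B = 0 then \<Delta> else min (norm g / mat_norm B) \<Delta>)"

text \<open>The sequences \<open>x\<close>, \<open>\<Delta>\<close>, \<open>B\<close>, \<open>s\<close> form an infinite run of the algorithm.
  The model decrease can vanish only if \<open>grad f (x k) = 0\<close>; the ratio is then \<open>0\<close> and the
  iteration counts as unsuccessful.\<close>

definition trust_region_run ::
  "(real^'n \<Rightarrow> real) \<Rightarrow> real \<Rightarrow> real \<Rightarrow> real \<Rightarrow> real \<Rightarrow> real \<Rightarrow> real \<Rightarrow> real^'n \<Rightarrow> real \<Rightarrow>
   (nat \<Rightarrow> real^'n) \<Rightarrow> (nat \<Rightarrow> real) \<Rightarrow> (nat \<Rightarrow> real^'n^'n) \<Rightarrow> (nat \<Rightarrow> real^'n) \<Rightarrow> bool" where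
  "trust_region_run f \<kappa> \<eta>1 \<eta>2 \<gamma>1 \<gamma>2 \<gamma>3 x0 \<Delta>0 x \<Delta> B s \<longleftrightarrow>
     x 0 = x0 \<and> \<Delta> 0 = \<Delta>0 \<and>
     (\<forall>k. sym_mat (B k) \<and>
          norm (s k) \<le> \<Delta> k \<and>
          tr_model f (x k) (B k) 0 - tr_model f (x k) (B k) (s k)
            \<ge> \<kappa> * norm (grad f (x k)) * tr_min (grad f (x k)) (B k) (\<Delta> k) \<and>
          (let \<rho> = tr_ratio f (x k) (B k) (s k) in
             x (Suc k) = (if \<rho> \<ge> \<eta>1 then x k + s k else x k) \<and>
             (\<rho> \<ge> \<eta>2 \<longrightarrow> \<Delta> (Suc k) \<in> {\<Delta> k .. \<gamma>3 * \<Delta> k}) \<and>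
             (\<eta>1 \<le> \<rho> \<and> \<rho> < \<eta>2 \<longrightarrow> \<Delta> (Suc k) \<in> {\<gamma>2 * \<Delta> k .. \<Delta> k}) \<and>
             (\<rho> < \<eta>1 \<longrightarrow> \<Delta> (Suc k) \<in> {\<gamma>1 * \<Delta> k .. \<gamma>2 * \<Delta> k})))"

definition successful ::
  "(real^'n \<Rightarrow> real) \<Rightarrow> real \<Rightarrow> (nat \<Rightarrow> real^'n) \<Rightarrow> (nat \<Rightarrow> real^'n^'n) \<Rightarrow> (nat \<Rightarrow> real^'n) \<Rightarrow> nat set"
  where
  "successful f \<eta>1 x B s = {k. tr_ratio f (x k) (B k) (s k) \<ge> \<eta>1}"


section \<open>Limited-memory quasi-Newton updates\<close>

definition bfgs_update :: "real^'n^'n \<Rightarrow> real^'n \<Rightarrow> real^'n \<Rightarrow> real^'n^'n" where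
  "bfgs_update B s y =
     B - (1 / (s \<bullet> (B *v s))) *\<^sub>R (B ** outer s s ** B) + (1 / (s \<bullet> y)) *\<^sub>R outer y y"

definition sr1_update :: "real^'n^'n \<Rightarrow> real^'n \<Rightarrow> real^'n \<Rightarrow> real^'n^'n" where
  "sr1_update B s y =
     B + (1 / ((y - B *v s) \<bullet> s)) *\<^sub>R outer (y - B *v s) (y - B *v s)"

definition psb_update :: "real^'n^'n \<Rightarrow> real^'n \<Rightarrow> real^'n \<Rightarrow> real^'n^'n" where
  "psb_update B s y =
     (let z = y - B *v s in
        B + (1 / (norm s)^2) *\<^sub>R (outer z s + outer s z)
          - ((z \<bullet> s) / (norm s)^4) *\<^sub>R outer s s)"

text \<open>The list \<open>idx k\<close> enumerates the indices \<open>i\<^sub>0, \<dots>, i\<^bsub>q-1\<^esub>\<close> of the pairs stored at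
  iteration \<open>k\<close>, in the order in which they are used, and \<open>Bin k j\<close> is the intermediate
  matrix \<open>B\<^bsub>k,j\<^esub>\<close>.\<close>

definition limited_memory ::
  "(real^'n^'n \<Rightarrow> real^'n \<Rightarrow> real^'n \<Rightarrow> real^'n^'n) \<Rightarrow> (nat \<Rightarrow> nat list) \<Rightarrow>
   (nat \<Rightarrow> real^'n) \<Rightarrow> (nat \<Rightarrow> real^'n) \<Rightarrow>
   (nat \<Rightarrow> nat \<Rightarrow> real^'n^'n) \<Rightarrow> (nat \<Rightarrow> real^'n^'n) \<Rightarrow> bool" where
  "limited_memory upd idx s y Bin B \<longleftrightarrow>
     (\<forall>k. (\<forall>j < length (idx k).
             Bin k (Suc j) = upd (Bin k j) (s (idx k ! j)) (y (idx k ! j))) \<and>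
          B k = Bin k (length (idx k)))"

definition grad_power_bounded ::
  "(real^'n \<Rightarrow> real) \<Rightarrow> real \<Rightarrow> (nat \<Rightarrow> real^'n) \<Rightarrow> (nat \<Rightarrow> real^'n^'n) \<Rightarrow> bool" where
  "grad_power_bounded f \<alpha> x B \<longleftrightarrow>
     (\<exists>b0 \<ge> 0. \<exists>b1 \<ge> 0. \<forall>k. mat_norm (B k) \<le> b0 + b1 * rpow (norm (grad f (x k))) \<alpha>)"

end

theory Submission
  imports Defs
begin

text \<open>Every step satisfies \<open>\<parallel>B\<^bsub>k,j+1\<^esub>\<parallel> \<le> a \<parallel>B\<^bsub>k,j\<^esub>\<parallel> + c\<close> with constants \<open>a\<close> and \<open>c\<close>
  that do not depend on \<open>k\<close> and \<open>j\<close>, and there are at most \<open>m\<close> steps. In the modified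
  updates (ii) and (iv) this is immediate from the safeguard; the others need a uniform bound
  \<open>\<parallel>y\<^sub>i\<parallel> \<le> C \<parallel>s\<^sub>i\<parallel>\<close> over all successful \<open>i\<close>. With \<open>\<delta> = 1 / (2 (L\<^sub>0 + L\<^sub>1))\<close>, generalized
  smoothness makes the gradient Lipschitz on every ball of radius \<open>\<delta>\<close>, with constant
  \<open>(1 + \<parallel>\<nabla>f(x)\<parallel>) / \<delta>\<close> at the centre \<open>x\<close>. A short gradient step then decreases \<open>f\<close> by an amount
  proportional to \<open>\<parallel>\<nabla>f(x)\<parallel>\<close>, so the gradient is bounded on the sublevel set of \<open>x\<^sub>0\<close>, which
  contains all iterates. Steps shorter than \<open>\<delta>\<close> are covered by the Lipschitz bound; for longer
  ones, where the segment may leave the sublevel set, \<open>\<parallel>y\<^sub>i\<parallel>\<close> is at most the sum of the gradient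
  norms at the two end points.\<close>

section \<open>The induced matrix norm\<close>

lemma norm_mult_vec_le: "norm (A *v v) \<le> mat_norm A * norm v"
  for A :: "real^'n^'n"
  unfolding mat_norm_def by (rule onorm) simp

lemma mat_norm_leI:
  fixes A :: "real^'n^'n"
  assumes "\<And>v. norm (A *v v) \<le> b * norm v"
  shows "mat_norm A \<le> b"
  unfolding mat_norm_def by (rule onorm_le) (rule assms)

lemma mat_norm_nonneg: "0 \<le> mat_norm A"
  for A :: "real^'n^'n"
  unfolding mat_norm_def by (rule onorm_pos_le) simp

lemma mat_norm_add: "mat_norm (A + C) \<le> mat_norm A + mat_norm C"
  for A C :: "real^'n^'n"
  unfolding mat_norm_def matrix_vector_mult_add_rdistrib
  by (rule onorm_triangle) simp_all

lemma mat_norm_scaleR: "mat_norm (r *\<^sub>R A) = \<bar>r\<bar> * mat_norm A"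
  for A :: "real^'n^'n"
proof -
  have "(\<lambda>v. (r *\<^sub>R A) *v v) = (\<lambda>v. r *\<^sub>R (A *v v))"
    by (simp add: scaleR_matrix_vector_assoc)
  then show ?thesis
    unfolding mat_norm_def by (simp add: onorm_scaleR)
qed

lemma mat_norm_diff: "mat_norm (A - C) \<le> mat_norm A + mat_norm C"
  for A C :: "real^'n^'n"
  using mat_norm_add[of A "- C"] mat_norm_scaleR[of "- 1" C] by simp

lemma outer_mult_vec: "outer u v *v w = (v \<bullet> w) *\<^sub>R u"
  for u v w :: "real^'n"
  by (simp add: vec_eq_iff outer_def matrix_vector_mult_def inner_vec_def sum_distrib_left
      mult_ac)

lemma mat_norm_outer_le: "mat_norm (outer u v) \<le> norm u * norm v"
  for u v :: "real^'n"
proof (rule mat_norm_leI)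
  fix w :: "real^'n"
  have "\<bar>v \<bullet> w\<bar> * norm u \<le> (norm v * norm w) * norm u"
    by (intro mult_right_mono Cauchy_Schwarz_ineq2) simp
  then show "norm (outer u v *v w) \<le> norm u * norm v * norm w"
    by (simp add: outer_mult_vec mult_ac)
qed

section \<open>Symmetric matrices and their quadratic forms\<close>

lemma sym_mat_inner: "sym_mat A \<Longrightarrow> u \<bullet> (A *v v) = (A *v u) \<bullet> v"
  for A :: "real^'n^'n"
  by (metis dot_lmul_matrix sym_mat_def transpose_matrix_vector)

text \<open>\<open>transpose A\<close> is the adjoint of \<open>A\<close>, so the hypothesis makes
  both act alike on every vector. Symmetry can then be checked on inner products, without
  entries.\<close>

lemma sym_matI:
  fixes A :: "real^'n^'n"
  assumes "\<And>u v. u \<bullet> (A *v v) = (A *v u) \<bullet> v"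
  shows "sym_mat A"
proof -
  have "u \<bullet> (transpose A *v v) = u \<bullet> (A *v v)" for u v
    by (metis assms dot_lmul_matrix inner_commute transpose_matrix_vector)
  then have "transpose A *v v = A *v v" for v
    using vector_eq_ldot by blast
  then show ?thesis
    unfolding sym_mat_def by (simp add: matrix_eq)
qed

text \<open>Polarization: \<open>4 u\<^sup>TAv \<le> (u + v)\<^sup>TA(u + v) \<le> b \<parallel>u + v\<parallel>\<^sup>2\<close>, applied to the multiple \<open>u\<close>
  of \<open>Av\<close> with \<open>\<parallel>u\<parallel> = \<parallel>v\<parallel>\<close>.\<close>

lemma mat_norm_le_quadratic_form:
  fixes A :: "real^'n^'n"
  assumes sym: "sym_mat A"
    and nonneg: "\<And>v. 0 \<le> v \<bullet> (A *v v)"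
    and le: "\<And>v. v \<bullet> (A *v v) \<le> b * (norm v)\<^sup>2"
    and "0 \<le> b"
  shows "mat_norm A \<le> b"
proof (rule mat_norm_leI)
  fix v
  show "norm (A *v v) \<le> b * norm v"
  proof (cases "A *v v = 0")
    case True
    then show ?thesis using \<open>0 \<le> b\<close> by simp
  next
    case False
    define u where "u = (norm v / norm (A *v v)) *\<^sub>R (A *v v)"
    have v: "0 < norm v" using False by auto
    have nu: "norm u = norm v"
      using False by (simp add: u_def)
    have uAv: "u \<bullet> (A *v v) = norm v * norm (A *v v)"
      using False by (simp add: u_def dot_square_norm power2_eq_square)
    have vAu: "v \<bullet> (A *v u) = u \<bullet> (A *v v)"
      using sym_mat_inner[OF sym] by (metis inner_commute)
    have "4 * (u \<bullet> (A *v v)) = (u + v) \<bullet> (A *v (u + v)) - (u - v) \<bullet> (A *v (u - v))"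
      by (simp add: algebra_simps matrix_vector_mult_diff_distrib
          matrix_vector_right_distrib vAu)
    also have "\<dots> \<le> b * (norm (u + v))\<^sup>2"
      using nonneg[of "u - v"] le[of "u + v"] by linarith
    also have "\<dots> \<le> b * (2 * norm v)\<^sup>2"
      using norm_triangle_ineq[of u v] nu \<open>0 \<le> b\<close>
      by (intro mult_left_mono power_mono) auto
    finally have "norm v * norm (A *v v) \<le> norm v * (b * norm v)"
      using uAv by (simp add: power2_eq_square mult_ac)
    then show ?thesis using v by simp
  qed
qed


section \<open>One quasi-Newton update\<close>

text \<open>Subtracting the first rank-one term leaves \<open>C\<close>, whose quadratic form lies
  between 0 and that of \<open>A\<close>, so the norm does not grow; the term added afterwards has
  norm at most \<open>(norm y)\<^sup>2 / (s \<bullet> y)\<close>.\<close>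

lemma bfgs_update_bound:
  fixes A :: "real^'n^'n"
  assumes pd: "pos_def A" and "s \<noteq> 0" and sy: "0 < s \<bullet> y"
  shows "pos_def (bfgs_update A s y)"
    and "mat_norm (bfgs_update A s y) \<le> mat_norm A + (norm y)\<^sup>2 / (s \<bullet> y)"
proof -
  have sym: "sym_mat A" and pos: "\<And>v. v \<noteq> 0 \<Longrightarrow> 0 < v \<bullet> (A *v v)"
    using pd by (auto simp: pos_def_def)
  have pos0: "0 \<le> v \<bullet> (A *v v)" for v
    using pos[of v] by (cases "v = 0") auto
  define q where "q = s \<bullet> (A *v s)"
  have q: "0 < q" using pos[OF \<open>s \<noteq> 0\<close>] by (simp add: q_def)
  have comm: "u \<bullet> (A *v v) = v \<bullet> (A *v u)" for u v
    using sym_mat_inner[OF sym] by (metis inner_commute)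
  define C where "C = A - (1 / q) *\<^sub>R (A ** outer s s ** A)"
  have Cv: "C *v v = A *v v - ((s \<bullet> (A *v v)) / q) *\<^sub>R (A *v s)" for v
    by (simp add: C_def matrix_vector_mult_diff_rdistrib scaleR_matrix_vector_assoc[symmetric]
        matrix_vector_mul_assoc[symmetric] outer_mult_vec matrix_vector_mult_scaleR)
  have Cquad: "v \<bullet> (C *v v) = v \<bullet> (A *v v) - (s \<bullet> (A *v v))\<^sup>2 / q" for v
    by (simp add: Cv inner_diff_right comm[of v s] power2_eq_square)
  \<comment> \<open>\<open>C\<close> is the form of \<open>A\<close> evaluated at the \<open>A\<close>-orthogonal projection along \<open>s\<close>.\<close>
  have Cproj: "v \<bullet> (C *v v) = w \<bullet> (A *v w)" if "w = v - ((s \<bullet> (A *v v)) / q) *\<^sub>R s" for v w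
  proof -
    define c where "c = (s \<bullet> (A *v v)) / q"
    have "s \<bullet> (A *v v) = c * q" using q by (simp add: c_def)
    then show ?thesis
      using q that
      by (simp add: Cquad c_def[symmetric] matrix_vector_mult_diff_distrib inner_diff_left
          inner_diff_right matrix_vector_mult_scaleR comm[of v s] q_def[symmetric]
          power2_eq_square)
  qed
  have Csym: "sym_mat C"
    by (rule sym_matI)
      (simp add: Cv inner_diff_left inner_diff_right comm inner_commute[of "A *v _"])
  have C0: "0 \<le> v \<bullet> (C *v v)" for v
    using Cproj pos0 by simp
  have Cle: "v \<bullet> (C *v v) \<le> mat_norm A * (norm v)\<^sup>2" for v
  proof -
    have "v \<bullet> (C *v v) \<le> v \<bullet> (A *v v)" using q by (simp add: Cquad)
    also have "\<dots> \<le> norm v * norm (A *v v)" by (rule norm_cauchy_schwarz)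
    also have "\<dots> \<le> norm v * (mat_norm A * norm v)"
      by (intro mult_left_mono norm_mult_vec_le) simp
    finally show ?thesis by (simp add: power2_eq_square mult_ac)
  qed
  have normC: "mat_norm C \<le> mat_norm A"
    using Csym C0 Cle mat_norm_nonneg by (rule mat_norm_le_quadratic_form)
  have upd: "bfgs_update A s y = C + (1 / (s \<bullet> y)) *\<^sub>R outer y y"
    by (simp add: bfgs_update_def C_def q_def)
  have updv: "bfgs_update A s y *v v = C *v v + ((y \<bullet> v) / (s \<bullet> y)) *\<^sub>R y" for v
    by (simp add: upd matrix_vector_mult_add_rdistrib scaleR_matrix_vector_assoc[symmetric]
        outer_mult_vec)
  show "pos_def (bfgs_update A s y)"
    unfolding pos_def_def
  proof (intro conjI allI impI)
    show "sym_mat (bfgs_update A s y)"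
      by (rule sym_matI)
        (simp add: updv inner_add_left inner_add_right sym_mat_inner[OF Csym]
          inner_commute[of _ y])
    fix v :: "real^'n" assume "v \<noteq> 0"
    have eq: "v \<bullet> (bfgs_update A s y *v v) = v \<bullet> (C *v v) + (y \<bullet> v)\<^sup>2 / (s \<bullet> y)"
      by (simp add: updv inner_add_right inner_commute[of v y] power2_eq_square)
    \<comment> \<open>\<open>c *\<^sub>R s\<close> is the \<open>A\<close>-orthogonal projection of
      \<open>v\<close> onto the line through \<open>s\<close>. The form of \<open>C\<close> vanishes
      exactly on this line, and there the \<open>y\<close> term supplies positivity.\<close>
    define c where "c = (s \<bullet> (A *v v)) / q"
    show "0 < v \<bullet> (bfgs_update A s y *v v)"
    proof (cases "v = c *\<^sub>R s")
      case True
      then have "y \<bullet> v = c * (s \<bullet> y)" "c \<noteq> 0"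
        using \<open>v \<noteq> 0\<close> by (auto simp: inner_commute)
      then have "0 < (y \<bullet> v)\<^sup>2 / (s \<bullet> y)" using sy by simp
      then show ?thesis using C0[of v] eq by linarith
    next
      case False
      then have "0 < v \<bullet> (C *v v)"
        using Cproj[of "v - c *\<^sub>R s" v] pos[of "v - c *\<^sub>R s"] by (simp add: c_def)
      then show ?thesis using eq sy by (simp add: add_pos_nonneg)
    qed
  qed
  have "mat_norm (bfgs_update A s y) \<le> mat_norm C + \<bar>1 / (s \<bullet> y)\<bar> * mat_norm (outer y y)"
    unfolding upd by (metis mat_norm_add mat_norm_scaleR)
  also have "\<dots> \<le> mat_norm A + \<bar>1 / (s \<bullet> y)\<bar> * (norm y * norm y)"
    by (intro add_mono normC mult_left_mono mat_norm_outer_le) simp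
  finally show "mat_norm (bfgs_update A s y) \<le> mat_norm A + (norm y)\<^sup>2 / (s \<bullet> y)"
    using sy by (simp add: power2_eq_square)
qed

lemma mat_norm_sr1_update:
  fixes A :: "real^'n^'n"
  shows "mat_norm (sr1_update A s y)
    \<le> mat_norm A + (norm (y - A *v s))\<^sup>2 / \<bar>s \<bullet> (y - A *v s)\<bar>"
proof -
  let ?z = "y - A *v s"
  have "mat_norm (sr1_update A s y) \<le> mat_norm A + \<bar>1 / (?z \<bullet> s)\<bar> * mat_norm (outer ?z ?z)"
    unfolding sr1_update_def by (metis mat_norm_add mat_norm_scaleR)
  also have "\<dots> \<le> mat_norm A + \<bar>1 / (?z \<bullet> s)\<bar> * (norm ?z * norm ?z)"
    by (intro add_left_mono mult_left_mono mat_norm_outer_le) simp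
  finally show ?thesis
    by (simp add: inner_commute power2_eq_square)
qed

text \<open>The factor 3 counts the three rank-one corrections: each has norm at most
  \<open>norm z / norm s\<close>, the last one by Cauchy-Schwarz.\<close>

lemma mat_norm_psb_update:
  fixes A :: "real^'n^'n"
  assumes "s \<noteq> 0"
  shows "mat_norm (psb_update A s y) \<le> mat_norm A + 3 * (norm (y - A *v s) / norm s)"
proof -
  define z where "z = y - A *v s"
  have s: "0 < norm s" using assms by simp
  let ?P = "(1 / (norm s)^2) *\<^sub>R (outer z s + outer s z)"
  let ?Q = "((z \<bullet> s) / (norm s)^4) *\<^sub>R outer s s"
  have "mat_norm (psb_update A s y) \<le> mat_norm (A + ?P) + mat_norm ?Q"
    unfolding psb_update_def z_def[symmetric] Let_def by (rule mat_norm_diff)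
  also have "\<dots> \<le> mat_norm A + mat_norm ?P + mat_norm ?Q"
    by (intro add_right_mono mat_norm_add)
  also have "mat_norm ?P \<le> (1 / (norm s)^2) * (norm z * norm s + norm s * norm z)"
  proof -
    have "mat_norm (outer z s + outer s z) \<le> norm z * norm s + norm s * norm z"
      by (meson add_mono mat_norm_add mat_norm_outer_le order_trans)
    then show ?thesis unfolding mat_norm_scaleR
      by (simp add: divide_right_mono)
  qed
  also have "(1 / (norm s)^2) * (norm z * norm s + norm s * norm z) = 2 * (norm z / norm s)"
    using s by (simp add: field_simps power2_eq_square)
  also have "mat_norm ?Q \<le> (norm z * norm s / (norm s)^4) * (norm s * norm s)"
    unfolding mat_norm_scaleR
    by (intro mult_mono mat_norm_outer_le mat_norm_nonneg)
      (simp_all add: abs_divide divide_right_mono Cauchy_Schwarz_ineq2)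
  also have "\<dots> = norm z / norm s"
    using s by (simp add: field_simps power4_eq_xxxx)
  finally show ?thesis by (simp add: z_def)
qed


section \<open>Iterating the updates\<close>

text \<open>Since \<open>1 \<le> a\<close>, each added \<open>c\<close> is at most
  \<open>a ^ j * c\<close>. This replaces the geometric sum by a form that also covers
  \<open>a = 1\<close>.\<close>

lemma affine_iteration_bound:
  fixes u :: "nat \<Rightarrow> real"
  assumes step: "\<And>j. j < n \<Longrightarrow> u (Suc j) \<le> a * u j + c"
    and "1 \<le> a" "0 \<le> c"
  shows "j \<le> n \<Longrightarrow> u j \<le> a ^ j * (u 0 + real j * c)"
proof (induction j)
  case 0
  then show ?case by simp
next
  case (Suc j)
  have "u (Suc j) \<le> a * u j + c" using step Suc.prems by simp
  also have "\<dots> \<le> a * (a ^ j * (u 0 + real j * c)) + a ^ Suc j * c"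
    using Suc assms mult_right_mono[OF one_le_power[OF \<open>1 \<le> a\<close>, of "Suc j"] \<open>0 \<le> c\<close>]
    by (intro add_mono mult_left_mono) auto
  also have "\<dots> = a ^ Suc j * (u 0 + real (Suc j) * c)" by (simp add: algebra_simps)
  finally show ?case .
qed

text \<open>The iterated bound is affine in the initial norm, so the gradient power is only
  rescaled, and \<open>m\<close> in place of the list length makes the constants independent of
  \<open>k\<close>. The step estimate concerns only the matrices and pairs that occur, so that the
  safeguards can enter it.\<close>

lemma grad_power_bounded_limited_memory:
  fixes f :: "real^'n \<Rightarrow> real"
  assumes init: "grad_power_bounded f \<alpha> x (\<lambda>k. Bin k 0)"
    and lm: "limited_memory upd idx s y Bin B"
    and len: "\<And>k. length (idx k) \<le> m"
    and a: "1 \<le> a" and c: "0 \<le> c"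
    and step: "\<And>k j. j < length (idx k) \<Longrightarrow>
      mat_norm (upd (Bin k j) (s (idx k ! j)) (y (idx k ! j))) \<le> a * mat_norm (Bin k j) + c"
  shows "grad_power_bounded f \<alpha> x B"
proof -
  obtain b0 b1 where b: "0 \<le> b0" "0 \<le> b1"
    and le: "\<And>k. mat_norm (Bin k 0) \<le> b0 + b1 * rpow (norm (grad f (x k))) \<alpha>"
    using init unfolding grad_power_bounded_def by blast
  have "mat_norm (B k) \<le> a ^ m * (b0 + m * c) + (a ^ m * b1) * rpow (norm (grad f (x k))) \<alpha>"
    for k
  proof -
    let ?q = "length (idx k)"
    have "mat_norm (Bin k ?q) \<le> a ^ ?q * (mat_norm (Bin k 0) + real ?q * c)"
      using lm step a c unfolding limited_memory_def
      by (intro affine_iteration_bound[where n = ?q]) auto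
    also have "\<dots> \<le> a ^ m * ((b0 + b1 * rpow (norm (grad f (x k))) \<alpha>) + real m * c)"
      using a c len[of k] le[of k] mat_norm_nonneg[of "Bin k 0"]
      by (intro mult_mono add_mono power_increasing mult_right_mono add_nonneg_nonneg
          mult_nonneg_nonneg) auto
    finally show ?thesis using lm unfolding limited_memory_def by (simp add: algebra_simps)
  qed
  then show ?thesis
    unfolding grad_power_bounded_def using a b c
    by (intro exI[of _ "a ^ m * (b0 + m * c)"] conjI exI[of _ "a ^ m * b1"]) auto
qed


section \<open>Gradients of generalized smooth functions\<close>

text \<open>Reduces every exponent in the unit interval to affine growth, so that all \<alpha> are
  treated alike.\<close>

lemma rpow_le_one_plus:
  assumes "0 \<le> r" "0 \<le> a" "a \<le> 1"
  shows "rpow r a \<le> 1 + r"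
proof -
  have "r powr a \<le> 1 + r"
  proof (cases "r \<le> 1")
    case True
    then have "r powr a \<le> 1 powr a" using assms by (intro powr_mono2) auto
    then show ?thesis using assms by simp
  next
    case False
    then have "r powr a \<le> r powr 1" using assms by (intro powr_mono) auto
    then show ?thesis using assms by simp
  qed
  then show ?thesis using assms by (simp add: rpow_def)
qed

text \<open>A non-integrable \<open>h\<close> has integral \<open>0\<close>.\<close>

lemma integral_unit_interval_le:
  fixes h :: "real \<Rightarrow> real"
  assumes "\<And>t. t \<in> {0..1} \<Longrightarrow> h t \<le> M" "0 \<le> M"
  shows "integral {0..1} h \<le> M"
proof (cases "h integrable_on {0..1}")
  case True
  then have "integral {0..1} h \<le> integral {0..1} (\<lambda>t::real. M)"
    using assms by (intro integral_le) auto
  then show ?thesis by simp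
next
  case False
  then show ?thesis using assms by (simp add: not_integrable_integral)
qed

text \<open>A bootstrap: by compactness the gradient norm has a maximum \<open>M\<close> on the
  ball, smoothness gives a Lipschitz estimate in terms of \<open>M\<close>, and the radius is small
  enough to absorb \<open>M\<close> into the gradient norm at the centre.\<close>

lemma gen_smooth_local_lipschitz:
  fixes f :: "real^'n \<Rightarrow> real"
  assumes sm: "gen_smooth \<alpha> L0 L1 f" and \<alpha>: "0 \<le> \<alpha>" "\<alpha> \<le> 1" and L: "0 \<le> L0" "0 \<le> L1"
    and \<delta>: "\<delta> = 1 / (2 * (L0 + L1))"
    and "norm (v - x) \<le> \<delta>"
  shows "norm (grad f v - grad f x) \<le> (1 + norm (grad f x)) / \<delta> * norm (v - x)"
proof -
  have L01: "0 < L0 + L1" and cont: "continuous_on UNIV (grad f)"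
    using sm L unfolding gen_smooth_def continuously_differentiable_def by auto
  have \<delta>0: "0 < \<delta>" using L01 \<delta> by simp
  define G where "G = norm (grad f x)"
  have "continuous_on (cball x \<delta>) (\<lambda>w. norm (grad f w))"
    by (intro continuous_on_norm continuous_on_subset[OF cont]) simp
  then obtain p where p: "p \<in> cball x \<delta>"
    and max: "\<And>w. w \<in> cball x \<delta> \<Longrightarrow> norm (grad f w) \<le> norm (grad f p)"
    using continuous_attains_sup[of "cball x \<delta>" "\<lambda>w. norm (grad f w)"] \<delta>0 by auto
  define M where "M = norm (grad f p)"
  have M0: "0 \<le> M" by (simp add: M_def)
  have lip: "norm (grad f w - grad f x) \<le> (L0 + L1 * (1 + M)) * norm (w - x)"
    if w: "w \<in> cball x \<delta>" for w
  proof -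
    have "rpow (norm (grad f (w + t *\<^sub>R (x - w)))) \<alpha> \<le> 1 + M" if t: "t \<in> {0..1}" for t
    proof -
      have "w + t *\<^sub>R (x - w) = (1 - t) *\<^sub>R w + t *\<^sub>R x" by (simp add: algebra_simps)
      also have "\<dots> \<in> cball x \<delta>"
        using t w \<delta>0 by (intro convexD[OF convex_cball]) auto
      finally show ?thesis
        using max rpow_le_one_plus[OF norm_ge_zero \<alpha>] unfolding M_def
        by (meson add_left_mono order_trans)
    qed
    then have "integral {0..1} (\<lambda>t. rpow (norm (grad f (w + t *\<^sub>R (x - w)))) \<alpha>) \<le> 1 + M"
      using M0 by (intro integral_unit_interval_le) auto
    then have "(L0 + L1 * integral {0..1} (\<lambda>t. rpow (norm (grad f (w + t *\<^sub>R (x - w)))) \<alpha>))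
        * norm (w - x) \<le> (L0 + L1 * (1 + M)) * norm (w - x)"
      using L by (intro mult_right_mono add_left_mono mult_left_mono) auto
    then show ?thesis
      using sm unfolding gen_smooth_def by (meson order_trans)
  qed
  \<comment> \<open>Merges \<open>L0\<close> and \<open>L1\<close> into one factor:
    \<open>1 / (2 * \<delta>)\<close> is \<open>L0 + L1\<close>.\<close>
  have K: "L0 + L1 * (1 + r) \<le> (1 + r) * (1 / (2 * \<delta>))" if "0 \<le> r" for r
  proof -
    have "1 / (2 * \<delta>) = L0 + L1" using L01 \<delta> by simp
    then show ?thesis using that L by (simp add: algebra_simps)
  qed
  \<comment> \<open>Taking \<open>w = p\<close> closes the estimate for the maximum: \<open>M \<le> G + (1 + M) / 2\<close>.\<close>
  have "M - G \<le> norm (grad f p - grad f x)"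
    unfolding M_def G_def by (rule norm_triangle_ineq2)
  also have "\<dots> \<le> (L0 + L1 * (1 + M)) * norm (p - x)" by (rule lip[OF p])
  also have "\<dots> \<le> ((1 + M) * (1 / (2 * \<delta>))) * \<delta>"
    using p K[OF M0] M0 \<delta>0 L by (intro mult_mono) (auto simp: dist_norm norm_minus_commute)
  also have "\<dots> = (1 + M) / 2" using \<delta>0 by simp
  finally have M: "1 + M \<le> 2 * (1 + G)" by simp
  have "norm (grad f v - grad f x) \<le> (L0 + L1 * (1 + M)) * norm (v - x)"
    using assms(7) by (intro lip) (simp add: dist_norm norm_minus_commute)
  also have "\<dots> \<le> ((1 + M) * (1 / (2 * \<delta>))) * norm (v - x)"
    by (intro mult_right_mono K M0) simp
  also have "\<dots> \<le> ((2 * (1 + G)) * (1 / (2 * \<delta>))) * norm (v - x)"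
    using M \<delta>0 by (intro mult_right_mono) auto
  also have "(2 * (1 + G)) * (1 / (2 * \<delta>)) = (1 + G) / \<delta>"
    using \<delta>0 by (simp add: field_simps)
  finally show ?thesis by (simp add: G_def)
qed

text \<open>Moving by \<open>\<delta> / 4\<close> against the normalized gradient lowers
  \<open>f\<close> by at least \<open>\<delta> * G / 8\<close>, which cannot exceed
  \<open>f x - l\<close>; inserting \<delta> gives the factor 16.\<close>

lemma gen_smooth_norm_grad_le:
  fixes f :: "real^'n \<Rightarrow> real"
  assumes sm: "gen_smooth \<alpha> L0 L1 f" and \<alpha>: "0 \<le> \<alpha>" "\<alpha> \<le> 1" and L: "0 \<le> L0" "0 \<le> L1"
    and lower: "\<And>v. l \<le> f v"
  shows "norm (grad f x) \<le> 1 + 16 * (L0 + L1) * (f x - l)"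
proof (cases "norm (grad f x) \<le> 1")
  case True
  have "0 \<le> 16 * (L0 + L1) * (f x - l)" using L lower[of x] by simp
  then show ?thesis using True by linarith
next
  case False
  have L01: "0 < L0 + L1" and diff: "\<And>v. f differentiable (at v)"
    using sm L unfolding gen_smooth_def continuously_differentiable_def by auto
  define \<delta> where "\<delta> = 1 / (2 * (L0 + L1))"
  have \<delta>0: "0 < \<delta>" using L01 by (simp add: \<delta>_def)
  define G where "G = norm (grad f x)"
  have G: "1 < G" using False by (simp add: G_def)
  define u where "u = (1 / G) *\<^sub>R grad f x"
  have nu: "norm u = 1" using G by (auto simp: u_def G_def)
  have gu: "grad f x \<bullet> u = G"
    using G by (simp add: u_def G_def dot_square_norm power2_eq_square)
  have "((\<lambda>t. f (x - t *\<^sub>R u)) has_real_derivative - (grad f (x - t *\<^sub>R u) \<bullet> u)) (at t)" for t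
  proof -
    have f': "(f has_derivative (\<lambda>h. h \<bullet> grad f (x - t *\<^sub>R u))) (at (x - t *\<^sub>R u))"
      using GDERIV_grad[OF diff] unfolding gderiv_def .
    have "((\<lambda>t. x - t *\<^sub>R u) has_derivative (\<lambda>h. - (h *\<^sub>R u))) (at t)"
      by (auto intro!: derivative_eq_intros)
    from has_derivative_compose[OF this f'] show ?thesis
      unfolding has_field_derivative_def
      by (rule has_derivative_eq_rhs) (simp add: fun_eq_iff inner_commute)
  qed
  then obtain \<xi> where \<xi>: "0 < \<xi>" "\<xi> < \<delta> / 4"
    and mvt: "f (x - (\<delta> / 4) *\<^sub>R u) - f (x - 0 *\<^sub>R u)
      = (\<delta> / 4 - 0) * - (grad f (x - \<xi> *\<^sub>R u) \<bullet> u)"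
    using MVT2[of 0 "\<delta> / 4" "\<lambda>t. f (x - t *\<^sub>R u)" "\<lambda>t. - (grad f (x - t *\<^sub>R u) \<bullet> u)"] \<delta>0
    by auto
  have "norm (grad f (x - \<xi> *\<^sub>R u) - grad f x)
      \<le> (1 + norm (grad f x)) / \<delta> * norm (x - \<xi> *\<^sub>R u - x)"
    using \<xi> \<delta>0 nu by (intro gen_smooth_local_lipschitz[OF sm \<alpha> L \<delta>_def]) simp
  also have "\<dots> = (1 + G) / \<delta> * \<xi>" using \<xi> nu by (simp add: G_def)
  also have "\<dots> \<le> (1 + G) / \<delta> * (\<delta> / 4)"
    using \<xi> \<delta>0 G by (intro mult_left_mono) auto
  \<comment> \<open>Here \<open>1 < G\<close> is used: \<open>(1 + G) / 4 \<le> G / 2\<close>. This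
    is why the case of gradient norm at most 1 was split off.\<close>
  also have "\<dots> \<le> G / 2" using \<delta>0 G by simp
  finally have "norm (grad f (x - \<xi> *\<^sub>R u) - grad f x) \<le> G / 2" .
  then have "\<bar>(grad f (x - \<xi> *\<^sub>R u) - grad f x) \<bullet> u\<bar> \<le> G / 2"
    using Cauchy_Schwarz_ineq2[of "grad f (x - \<xi> *\<^sub>R u) - grad f x" u] nu by simp
  then have "G / 2 \<le> grad f (x - \<xi> *\<^sub>R u) \<bullet> u"
    using gu unfolding inner_diff_left by linarith
  then have "(\<delta> / 4) * (G / 2) \<le> (\<delta> / 4) * (grad f (x - \<xi> *\<^sub>R u) \<bullet> u)"
    using \<delta>0 by (intro mult_left_mono) auto
  then have "\<delta> * G / 8 \<le> f x - l"
    using mvt lower[of "x - (\<delta> / 4) *\<^sub>R u"] by (simp add: mult.commute)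
  then have "G \<le> 16 * (L0 + L1) * (f x - l)"
    using L01 by (simp add: \<delta>_def field_simps)
  then show ?thesis by (simp add: G_def)
qed


section \<open>Successful steps\<close>

lemma trust_region_run_descent:
  assumes run: "trust_region_run f \<kappa> \<eta>1 \<eta>2 \<gamma>1 \<gamma>2 \<gamma>3 x0 \<Delta>0 x \<Delta> B s"
    and "0 < \<kappa>" "0 < \<eta>1"
  shows "f (x k) \<le> f x0"
proof (induction k)
  case 0
  then show ?case using run by (simp add: trust_region_run_def)
next
  case (Suc k)
  let ?d = "tr_model f (x k) (B k) 0 - tr_model f (x k) (B k) (s k)"
  have \<Delta>: "norm (s k) \<le> \<Delta> k"
    and dec: "\<kappa> * norm (grad f (x k)) * tr_min (grad f (x k)) (B k) (\<Delta> k) \<le> ?d"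
    and next_x: "x (Suc k) = (if \<eta>1 \<le> tr_ratio f (x k) (B k) (s k) then x k + s k else x k)"
    using run unfolding trust_region_run_def Let_def by blast+
  \<comment> \<open>The radius is nonnegative because it bounds the norm of the step.\<close>
  have "0 \<le> tr_min (grad f (x k)) (B k) (\<Delta> k)"
    using order_trans[OF norm_ge_zero \<Delta>] mat_norm_nonneg[of "B k"] by (simp add: tr_min_def)
  then have d: "0 \<le> ?d"
    using dec \<open>0 < \<kappa>\<close> by (meson mult_nonneg_nonneg norm_ge_zero order_less_imp_le order_trans)
  show ?case
  proof (cases "\<eta>1 \<le> tr_ratio f (x k) (B k) (s k)")
    case True
    \<comment> \<open>Strict positivity rules out a zero denominator, for which the quotient would
      be 0.\<close>
    then have "0 < (f (x k) - f (x k + s k)) / ?d"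
      using \<open>0 < \<eta>1\<close> by (simp add: tr_ratio_def)
    then have "f (x k + s k) < f (x k)"
      using d by (simp add: zero_less_divide_iff)
    then show ?thesis using Suc True next_x by simp
  next
    case False
    then show ?thesis using Suc next_x by simp
  qed
qed

lemma successful_gradient_difference_bound:
  fixes f :: "real^'n \<Rightarrow> real"
  assumes sm: "gen_smooth \<alpha> L0 L1 f" and \<alpha>: "0 \<le> \<alpha>" "\<alpha> \<le> 1" and L: "0 \<le> L0" "0 \<le> L1"
    and bdd: "bdd_below (range f)"
    and run: "trust_region_run f \<kappa> \<eta>1 \<eta>2 \<gamma>1 \<gamma>2 \<gamma>3 x0 \<Delta>0 x \<Delta> B s"
    and "0 < \<kappa>" "0 < \<eta>1"
  obtains C where "0 \<le> C"
    and "\<And>i. i \<in> successful f \<eta>1 x B s \<Longrightarrow>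
      norm (grad f (x i + s i) - grad f (x i)) \<le> C * norm (s i)"
proof -
  obtain l where l: "\<And>v. l \<le> f v"
    using bdd by (auto simp: bdd_below_def)
  have L01: "0 < L0 + L1" using sm L unfolding gen_smooth_def by auto
  define \<delta> where "\<delta> = 1 / (2 * (L0 + L1))"
  have \<delta>0: "0 < \<delta>" using L01 by (simp add: \<delta>_def)
  define G where "G = 1 + 16 * (L0 + L1) * (f x0 - l)"
  have G0: "0 \<le> G" using L l[of x0] by (simp add: G_def)
  have grad_le: "norm (grad f (x k)) \<le> G" for k
  proof -
    have "norm (grad f (x k)) \<le> 1 + 16 * (L0 + L1) * (f (x k) - l)"
      by (rule gen_smooth_norm_grad_le[OF sm \<alpha> L l])
    also have "\<dots> \<le> G"
      unfolding G_def using trust_region_run_descent[OF run \<open>0 < \<kappa>\<close> \<open>0 < \<eta>1\<close>, of k] L01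
      by (intro add_left_mono mult_left_mono) auto
    finally show ?thesis .
  qed
  show ?thesis
  \<comment> \<open>The constant serves both regimes: it exceeds the local Lipschitz constant, and
    its product with \<delta> exceeds \<open>2 * G\<close>.\<close>
  proof (rule that[of "2 * (1 + G) / \<delta>"])
    show "0 \<le> 2 * (1 + G) / \<delta>" using G0 \<delta>0 by simp
    fix i assume i: "i \<in> successful f \<eta>1 x B s"
    show "norm (grad f (x i + s i) - grad f (x i)) \<le> 2 * (1 + G) / \<delta> * norm (s i)"
    proof (cases "norm (s i) \<le> \<delta>")
      case True
      then have "norm (grad f (x i + s i) - grad f (x i))
          \<le> (1 + norm (grad f (x i))) / \<delta> * norm (s i)"
        using gen_smooth_local_lipschitz[OF sm \<alpha> L \<delta>_def, of "x i + s i" "x i"] by simp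
      also have "\<dots> \<le> 2 * (1 + G) / \<delta> * norm (s i)"
        using grad_le[of i] G0 \<delta>0 by (intro mult_right_mono divide_right_mono) auto
      finally show ?thesis .
    next
      case False
      \<comment> \<open>Success matters here: the trial point is itself an iterate, so its gradient
        is bounded by \<open>G\<close> too.\<close>
      have "x (Suc i) = x i + s i"
        using run i unfolding trust_region_run_def successful_def Let_def by auto
      then have "norm (grad f (x i + s i) - grad f (x i)) \<le> 2 * (1 + G)"
        using norm_triangle_ineq4[of "grad f (x i + s i)" "grad f (x i)"]
          grad_le[of i] grad_le[of "Suc i"] by simp
      also have "\<dots> = 2 * (1 + G) / \<delta> * \<delta>" using \<delta>0 by simp
      also have "\<dots> \<le> 2 * (1 + G) / \<delta> * norm (s i)"
        using False G0 \<delta>0 by (intro mult_left_mono) auto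
      finally show ?thesis .
    qed
  qed
qed


section \<open>The bounds for the limited-memory updates\<close>

theorem proposition3p2:
  fixes f :: "real^'n \<Rightarrow> real"
    and \<alpha> L0 L1 \<kappa> \<eta>1 \<eta>2 \<gamma>1 \<gamma>2 \<gamma>3 \<Delta>0 :: real
    and x0 :: "real^'n"
    and x s y :: "nat \<Rightarrow> real^'n"
    and \<Delta> :: "nat \<Rightarrow> real"
    and B :: "nat \<Rightarrow> real^'n^'n"
    and Bin :: "nat \<Rightarrow> nat \<Rightarrow> real^'n^'n"
    and idx :: "nat \<Rightarrow> nat list"
    and m :: nat
  assumes "continuously_differentiable f"
    and "bdd_below (range f)"
    and "0 \<le> \<alpha>" "\<alpha> \<le> 1" "0 \<le> L0" "0 \<le> L1"
    and "gen_smooth \<alpha> L0 L1 f"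
    and "0 < \<kappa>" "\<kappa> \<le> 1/2"
    and "0 < \<eta>1" "\<eta>1 \<le> \<eta>2" "\<eta>2 < 1"
    and "0 < \<gamma>1" "\<gamma>1 \<le> \<gamma>2" "\<gamma>2 < 1" "1 \<le> \<gamma>3"
    and "0 < \<Delta>0"
    and "trust_region_run f \<kappa> \<eta>1 \<eta>2 \<gamma>1 \<gamma>2 \<gamma>3 x0 \<Delta>0 x \<Delta> B s"
    and "\<forall>k. distinct (idx k) \<and> set (idx k) \<subseteq> successful f \<eta>1 x B s \<and> length (idx k) \<le> m"
    and "\<forall>k. \<forall>i \<in> set (idx k). s i \<noteq> 0 \<and> y i = grad f (x i + s i) - grad f (x i)"
    and "grad_power_bounded f \<alpha> x (\<lambda>k. Bin k 0)"
  shows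
    "((\<forall>k. pos_def (Bin k 0)) \<and>
      (\<exists>\<omega>. 0 < \<omega> \<and> \<omega> < 1 \<and>
        (\<forall>k. \<forall>j < length (idx k). let i = idx k ! j in
           y i \<noteq> 0 \<and> s i \<bullet> y i \<ge> \<omega> * norm (s i) * norm (y i))) \<and>
      limited_memory bfgs_update idx s y Bin B
      \<longrightarrow> grad_power_bounded f \<alpha> x B)
    \<and>
     ((\<forall>k. pos_def (Bin k 0)) \<and>
      (\<exists>\<omega>. 0 < \<omega> \<and> \<omega> < 1 \<and>
        (\<forall>k. \<forall>j < length (idx k). let i = idx k ! j in
           y i \<noteq> 0 \<and> s i \<bullet> y i \<ge> \<omega> * (norm (y i))^2)) \<and>
      limited_memory bfgs_update idx s y Bin B
      \<longrightarrow> grad_power_bounded f \<alpha> x B)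
    \<and>
     ((\<exists>\<omega>. 0 < \<omega> \<and> \<omega> < 1 \<and>
        (\<forall>k. \<forall>j < length (idx k). let i = idx k ! j; z = y i - Bin k j *v s i in
           z \<noteq> 0 \<and> \<bar>s i \<bullet> z\<bar> \<ge> \<omega> * norm (s i) * norm z)) \<and>
      limited_memory sr1_update idx s y Bin B
      \<longrightarrow> grad_power_bounded f \<alpha> x B)
    \<and>
     ((\<exists>\<omega>. 0 < \<omega> \<and> \<omega> < 1 \<and>
        (\<forall>k. \<forall>j < length (idx k). let i = idx k ! j; z = y i - Bin k j *v s i in
           z \<noteq> 0 \<and> \<bar>s i \<bullet> z\<bar> \<ge> \<omega> * (norm z)^2)) \<and>
      limited_memory sr1_update idx s y Bin B
      \<longrightarrow> grad_power_bounded f \<alpha> x B)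
    \<and>
     (limited_memory psb_update idx s y Bin B
      \<longrightarrow> grad_power_bounded f \<alpha> x B)
    \<and>
     ((\<exists>\<omega>. 0 < \<omega> \<and>
        (\<forall>k. \<forall>j < length (idx k). let i = idx k ! j; z = y i - Bin k j *v s i in
           norm (s i) \<ge> \<omega> * norm z)) \<and>
      limited_memory psb_update idx s y Bin B
      \<longrightarrow> grad_power_bounded f \<alpha> x B)"
proof -

  \<comment> \<open>Uniform estimates for the stored pairs\<close>
  note gpb = grad_power_bounded_limited_memory[where Bin = Bin, OF assms(21)]
  have len: "length (idx k) \<le> m" for k
    using assms(19) by blast
  have s0: "s (idx k ! j) \<noteq> 0" if "j < length (idx k)" for k j
    using assms(20) that nth_mem by blast
  obtain C where C: "0 \<le> C" and C_bound: "\<And>i. i \<in> successful f \<eta>1 x B s \<Longrightarrow>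
      norm (grad f (x i + s i) - grad f (x i)) \<le> C * norm (s i)"
    using successful_gradient_difference_bound[OF assms(7,3-6,2,18,8,10)] by blast
  have yC: "norm (y (idx k ! j)) \<le> C * norm (s (idx k ! j))" if "j < length (idx k)" for k j
    using assms(19,20) that nth_mem C_bound by (metis subsetD)
  \<comment> \<open>The residual of the secant equation depends on the current matrix; this is how a
    factor above 1 enters the estimates for (iii) and (v).\<close>
  have zC: "norm (y (idx k ! j) - Bin k j *v s (idx k ! j)) / norm (s (idx k ! j))
      \<le> C + mat_norm (Bin k j)" if "j < length (idx k)" for k j
  proof -
    have "norm (y (idx k ! j) - Bin k j *v s (idx k ! j))
        \<le> C * norm (s (idx k ! j)) + mat_norm (Bin k j) * norm (s (idx k ! j))"
      using yC[OF that] norm_mult_vec_le[of "Bin k j" "s (idx k ! j)"]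
      by (intro order_trans[OF norm_triangle_ineq4]) simp
    then show ?thesis using s0[OF that] by (simp add: field_simps)
  qed

  \<comment> \<open>BFGS: a common core for (i) and (ii), which differ only in
    \<open>c\<close>\<close>
  have bfgs: "grad_power_bounded f \<alpha> x B"
    if lm: "limited_memory bfgs_update idx s y Bin B" and pd: "\<forall>k. pos_def (Bin k 0)"
      and c: "0 \<le> c"
      and sy: "\<And>k j. j < length (idx k) \<Longrightarrow> 0 < s (idx k ! j) \<bullet> y (idx k ! j) \<and>
        (norm (y (idx k ! j)))\<^sup>2 / (s (idx k ! j) \<bullet> y (idx k ! j)) \<le> c" for c
  proof -
    \<comment> \<open>The norm bound for one update requires a positive definite matrix, so this
      property is first carried along the recursion.\<close>
    have "j \<le> length (idx k) \<Longrightarrow> pos_def (Bin k j)" for k j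
    proof (induction j)
      case 0
      then show ?case using pd by simp
    next
      case (Suc j)
      then have "pos_def (bfgs_update (Bin k j) (s (idx k ! j)) (y (idx k ! j)))"
        using s0[of j k] sy[of j k] by (intro bfgs_update_bound) auto
      then show ?case using lm Suc.prems by (simp add: limited_memory_def)
    qed
    then have "mat_norm (bfgs_update (Bin k j) (s (idx k ! j)) (y (idx k ! j)))
        \<le> 1 * mat_norm (Bin k j) + c" if "j < length (idx k)" for k j
      using bfgs_update_bound(2)[of "Bin k j" "s (idx k ! j)" "y (idx k ! j)"]
        s0[of j k] sy[of j k] that by fastforce
    then show ?thesis by (intro gpb[OF lm len _ c]) auto
  qed
  have bfgs_i: "grad_power_bounded f \<alpha> x B"
    if lm: "limited_memory bfgs_update idx s y Bin B" and pd: "\<forall>k. pos_def (Bin k 0)"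
      and \<omega>: "0 < \<omega>"
      and cond: "\<forall>k. \<forall>j < length (idx k). let i = idx k ! j in
           y i \<noteq> 0 \<and> s i \<bullet> y i \<ge> \<omega> * norm (s i) * norm (y i)" for \<omega>
  \<comment> \<open>\<open>C / \<omega>\<close> arises from bounding one factor
    \<open>norm y\<close> by \<open>C * norm s\<close> and then applying the safeguard.\<close>
  proof (rule bfgs[OF lm pd, of "C / \<omega>"])
    show "0 \<le> C / \<omega>" using C \<omega> by simp
    fix k j assume j: "j < length (idx k)"
    let ?s = "s (idx k ! j)" and ?y = "y (idx k ! j)"
    have y0: "?y \<noteq> 0" and le: "\<omega> * norm ?s * norm ?y \<le> ?s \<bullet> ?y"
      using cond j by (auto simp: Let_def)
    have pos: "0 < ?s \<bullet> ?y"
      using le \<omega> y0 s0[OF j] by (meson less_le_trans mult_pos_pos zero_less_norm_iff)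
    have "\<omega> * (norm ?y)\<^sup>2 \<le> \<omega> * (C * norm ?s * norm ?y)"
      unfolding power2_eq_square using \<omega> yC[OF j]
      by (intro mult_left_mono mult_right_mono) auto
    also have "\<dots> \<le> C * (?s \<bullet> ?y)"
      using mult_left_mono[OF le C] by (simp add: mult_ac)
    finally show "0 < ?s \<bullet> ?y \<and> (norm ?y)\<^sup>2 / (?s \<bullet> ?y) \<le> C / \<omega>"
      using pos \<omega> by (simp add: field_simps)
  qed
  have bfgs_ii: "grad_power_bounded f \<alpha> x B"
    if lm: "limited_memory bfgs_update idx s y Bin B" and pd: "\<forall>k. pos_def (Bin k 0)"
      and \<omega>: "0 < \<omega>"
      and cond: "\<forall>k. \<forall>j < length (idx k). let i = idx k ! j in
           y i \<noteq> 0 \<and> s i \<bullet> y i \<ge> \<omega> * (norm (y i))^2" for \<omega>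
  proof (rule bfgs[OF lm pd, of "1 / \<omega>"])
    show "0 \<le> 1 / \<omega>" using \<omega> by simp
    fix k j assume j: "j < length (idx k)"
    let ?s = "s (idx k ! j)" and ?y = "y (idx k ! j)"
    have y0: "?y \<noteq> 0" and le: "\<omega> * (norm ?y)\<^sup>2 \<le> ?s \<bullet> ?y"
      using cond j by (auto simp: Let_def)
    have "0 < \<omega> * (norm ?y)\<^sup>2" using \<omega> y0 by simp
    then have "0 < ?s \<bullet> ?y" using le by linarith
    then show "0 < ?s \<bullet> ?y \<and> (norm ?y)\<^sup>2 / (?s \<bullet> ?y) \<le> 1 / \<omega>"
      using le \<omega> by (simp add: field_simps)
  qed

  \<comment> \<open>SR1: (iii) and (iv)\<close>
  have sr1_iii: "grad_power_bounded f \<alpha> x B"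
    if lm: "limited_memory sr1_update idx s y Bin B" and \<omega>: "0 < \<omega>"
      and cond: "\<forall>k. \<forall>j < length (idx k). let i = idx k ! j; z = y i - Bin k j *v s i in
           z \<noteq> 0 \<and> \<bar>s i \<bullet> z\<bar> \<ge> \<omega> * norm (s i) * norm z" for \<omega>
  \<comment> \<open>The safeguard bounds the correction by \<open>norm z / norm s\<close> over
    \<omega>, and \<open>zC\<close> splits this into a multiple of the current norm and a
    constant.\<close>
  proof (rule gpb[OF lm len, of "1 + 1 / \<omega>" "C / \<omega>"])
    show "1 \<le> 1 + 1 / \<omega>" "0 \<le> C / \<omega>" using C \<omega> by auto
    fix k j assume j: "j < length (idx k)"
    let ?s = "s (idx k ! j)" and ?z = "y (idx k ! j) - Bin k j *v s (idx k ! j)"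
    have z0: "?z \<noteq> 0" and le: "\<omega> * norm ?s * norm ?z \<le> \<bar>?s \<bullet> ?z\<bar>"
      using cond j by (auto simp: Let_def)
    have pos: "0 < \<omega> * norm ?s * norm ?z"
      using \<omega> z0 s0[OF j] by simp
    have "(norm ?z)\<^sup>2 / \<bar>?s \<bullet> ?z\<bar> \<le> (norm ?z)\<^sup>2 / (\<omega> * norm ?s * norm ?z)"
      using le pos by (intro divide_left_mono) (auto intro!: mult_pos_pos)
    also have "\<dots> = (norm ?z / norm ?s) / \<omega>"
      using z0 by (simp add: power2_eq_square field_simps)
    also have "\<dots> \<le> (C + mat_norm (Bin k j)) / \<omega>"
      using zC[OF j] \<omega> by (intro divide_right_mono) auto
    finally show "mat_norm (sr1_update (Bin k j) ?s (y (idx k ! j)))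
        \<le> (1 + 1 / \<omega>) * mat_norm (Bin k j) + C / \<omega>"
      using mat_norm_sr1_update[of "Bin k j" ?s "y (idx k ! j)"]
      by (simp add: algebra_simps add_divide_distrib)
  qed
  have sr1_iv: "grad_power_bounded f \<alpha> x B"
    if lm: "limited_memory sr1_update idx s y Bin B" and \<omega>: "0 < \<omega>"
      and cond: "\<forall>k. \<forall>j < length (idx k). let i = idx k ! j; z = y i - Bin k j *v s i in
           z \<noteq> 0 \<and> \<bar>s i \<bullet> z\<bar> \<ge> \<omega> * (norm z)^2" for \<omega>
  \<comment> \<open>The safeguard alone bounds the correction by \<open>1 / \<omega>\<close>, hence
    the factor 1.\<close>
  proof (rule gpb[OF lm len, of 1 "1 / \<omega>"])
    show "1 \<le> (1::real)" "0 \<le> 1 / \<omega>" using \<omega> by auto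
    fix k j assume j: "j < length (idx k)"
    let ?s = "s (idx k ! j)" and ?z = "y (idx k ! j) - Bin k j *v s (idx k ! j)"
    have z0: "?z \<noteq> 0" and le: "\<omega> * (norm ?z)\<^sup>2 \<le> \<bar>?s \<bullet> ?z\<bar>"
      using cond j by (auto simp: Let_def)
    have "0 < \<omega> * (norm ?z)\<^sup>2" using \<omega> z0 by simp
    then have "0 < \<bar>?s \<bullet> ?z\<bar>" using le by linarith
    then have "(norm ?z)\<^sup>2 / \<bar>?s \<bullet> ?z\<bar> \<le> 1 / \<omega>"
      using le \<omega> by (simp add: field_simps)
    then show "mat_norm (sr1_update (Bin k j) ?s (y (idx k ! j)))
        \<le> 1 * mat_norm (Bin k j) + 1 / \<omega>"
      using mat_norm_sr1_update[of "Bin k j" ?s "y (idx k ! j)"] by simp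
  qed

  \<comment> \<open>PSB: (v) and (vi)\<close>
  have psb_v: "grad_power_bounded f \<alpha> x B"
    if lm: "limited_memory psb_update idx s y Bin B"
  \<comment> \<open>With \<open>zC\<close>, three times the relative residual adds 3 to the factor 1
    and leaves \<open>3 * C\<close>.\<close>
  proof (rule gpb[OF lm len, of 4 "3 * C"])
    show "1 \<le> (4::real)" "0 \<le> 3 * C" using C by auto
    fix k j assume j: "j < length (idx k)"
    show "mat_norm (psb_update (Bin k j) (s (idx k ! j)) (y (idx k ! j)))
        \<le> 4 * mat_norm (Bin k j) + 3 * C"
      using mat_norm_psb_update[OF s0[OF j], of "Bin k j" "y (idx k ! j)"] zC[OF j]
      by linarith
  qed
  \<comment> \<open>(vi) is (v) under an additional hypothesis.\<close>
  show ?thesis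
    by (intro conjI impI; (elim conjE exE)?; rule bfgs_i bfgs_ii sr1_iii sr1_iv psb_v; assumption)
qed

end
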